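(* Let $1\le k\le n$ and $\mu>0$. The average execution time $T_{\rm avg}=\mathbb{E}[T]$ of a linear-coded distributed computing system with $n$ servers and straggling parameter $\mu$, using a given $(n,k)$ code (with a given decoder), satisfies $$T_{\rm avg}=\int_{0}^{\infty}P_e(\epsilon(\tau),n)\,d\tau=\frac{1}{k}+\frac{1}{\mu k}\int_{0}^{1}\frac{P_e(\epsilon,n)}{\epsilon}\,d\epsilon ,$$ where $\epsilon(\tau)=\exp(-\mu(k\tau-1))$ for $\tau\ge 1/k$ and $\epsilon(\tau)=1$ for $\tau<1/k$.
   Context: System model. A computational job is divided equally into $k$ tasks, encoded by an $(n,k)$ linear code into $n$ encoded tasks, and the $j$-th encoded task is assigned to the $j$-th of $n$ servers. The run times $T_1,\dots,T_n$ of the servers are i.i.d. with shifted-exponential distribution $\Pr(T_i\le t)=1-\exp(-\mu(kt-1))$ for $t\ge 1/k$, and $\Pr(T_i\le t)=0$ for $t<1/k$. Thus $\epsilon(t)=\Pr(T_i>t)$ is the probability that a given encoded task is not completed ("erased") by time $t$. Decodability. The code together with its decoder over erasure channels determines which sets $S\subseteq\{1,\dots,n\}$ of unerased encoded symbols are decodable, i.e. lead to successful decoding with probability $1$. A set of fewer than $k$ unerased symbols is never decodable, and any set containing a decodable set is decodable. $P_e(\epsilon,n)$ denotes the probability of decoding failure when each of the $n$ encoded symbols is erased independently with probability $\epsilon$, i.e. the probability that the set of unerased symbols is not decodable. The total job completion time $T$ is the first time $t$ at which the set $\{i: T_i\le t\}$ of servers that have finished is decodable ($T=\infty$ if this never happens).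 Equalities are understood in $[0,\infty]$. *)

theory Defs
  imports "HOL-Probability.Probability" "Jordan_Normal_Form.DL_Rank"
begin

(* Generator matrix of a k-dimensional code in F^n; codewords are the row-space elements u G. *)
definition linear_code :: "nat \<Rightarrow> nat \<Rightarrow> 'f::field mat \<Rightarrow> bool" where
  "linear_code n k G \<longleftrightarrow> G \<in> carrier_mat k n \<and> vec_space.rank k G = k"

definition encode :: "'f::field mat \<Rightarrow> 'f Matrix.vec \<Rightarrow> 'f Matrix.vec" where
  "encode G u = transpose_mat G *\<^sub>v u"

(* S is the set of unerased positions; positions are numbered 0, ..., n - 1. *)
definition received :: "nat \<Rightarrow> 'f Matrix.vec \<Rightarrow> nat set \<Rightarrow> 'f option Matrix.vec" where
  "received n c S = Matrix.vec n (\<lambda>i. if i \<in> S then Some (vec_index c i) else None)"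

(* Decoders may be randomised and need not be optimal; a deterministic decoder is a
   return_pmf. *)
type_synonym 'f decoder = "'f option Matrix.vec \<Rightarrow> 'f Matrix.vec pmf"

definition decodable :: "nat \<Rightarrow> nat \<Rightarrow> 'f::field mat \<Rightarrow> 'f decoder \<Rightarrow> nat set \<Rightarrow> bool" where
  "decodable n k G dec S \<longleftrightarrow>
     (\<forall>u\<in>carrier_vec k. measure_pmf.prob (dec (received n (encode G u) S)) {u} = 1)"

definition monotone_decoder :: "nat \<Rightarrow> nat \<Rightarrow> 'f::field mat \<Rightarrow> 'f decoder \<Rightarrow> bool" where
  "monotone_decoder n k G dec \<longleftrightarrow>
     (\<forall>S S'. S \<subseteq> S' \<and> S' \<subseteq> {..<n} \<and> decodable n k G dec S \<longrightarrow> decodable n k G dec S')"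

(* In the next two definitions D is the predicate "decodable"; e i means that symbol i is
   erased. *)
definition failure_prob :: "(nat set \<Rightarrow> bool) \<Rightarrow> real \<Rightarrow> nat \<Rightarrow> real" where
  "failure_prob D \<epsilon> n =
     measure_pmf.prob (Pi_pmf {..<n} False (\<lambda>_. bernoulli_pmf \<epsilon>)) {e. \<not> D {i\<in>{..<n}. \<not> e i}}"

(* The infimum is attained whenever the index set is nonempty (see completion_time_first), and
   is \<infinity> otherwise. *)
definition completion_time :: "(nat set \<Rightarrow> bool) \<Rightarrow> nat \<Rightarrow> (nat \<Rightarrow> real) \<Rightarrow> ennreal" where
  "completion_time D n x = (INF t\<in>{t. 0 \<le> t \<and> D {i\<in>{..<n}. x i \<le> t}}. ennreal t)"

definition run_time_cdf :: "nat \<Rightarrow> real \<Rightarrow> real \<Rightarrow> real" where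
  "run_time_cdf k \<mu> t = (if t \<ge> 1 / real k then 1 - exp (- \<mu> * (real k * t - 1)) else 0)"

definition erasure_prob :: "nat \<Rightarrow> real \<Rightarrow> real \<Rightarrow> real" where
  "erasure_prob k \<mu> t = (if t \<ge> 1 / real k then exp (- \<mu> * (real k * t - 1)) else 1)"

(* No decoder succeeds from fewer than k symbols, so this need not be assumed of decoders. *)
lemma decodable_imp_card_ge:
  fixes G :: "'f::field mat"
  assumes G: "G \<in> carrier_mat k n" and S: "S \<subseteq> {..<n}" and D: "decodable n k G dec S"
  shows "k \<le> card S"
proof (rule ccontr)
  assume less: "\<not> k \<le> card S"
  have "finite S" using S finite_subset by blast
  then obtain f where f: "bij_betw f {0..<card S} S"
    using ex_bij_betw_nat_finite by blast
  define A where "A = mat\<^sub>r k k (\<lambda>r. if r = card S then 0\<^sub>v k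
      else if r < card S then col G (f r) else 0\<^sub>v k)"
  have fS: "f r \<in> S" if "r < card S" for r
    using f that by (auto simp: bij_betw_def)
  have A: "A \<in> carrier_mat k k" by (simp add: A_def)
  have "det A = 0"
    unfolding A_def by (rule det_row_0) (use less G in auto)
  then obtain v where v: "v \<in> carrier_vec k" "v \<noteq> 0\<^sub>v k" and Av: "A *\<^sub>v v = 0\<^sub>v k"
    using det_0_iff_vec_prod_zero_field[OF A] by blast
  have z: "col G j \<bullet> v = 0" if "j \<in> S" for j
  proof -
    have "j \<in> f ` {0..<card S}" using f that by (simp add: bij_betw_def)
    then obtain r where r: "r < card S" "f r = j" by auto
    have "vec_index (A *\<^sub>v v) r = row A r \<bullet> v" using A r less by simp
    also have "row A r = col G j"
      using r less G unfolding A_def by (intro eq_vecI) auto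
    finally show ?thesis using Av r less by simp
  qed
  have eq: "received n (encode G v) S = received n (encode G (0\<^sub>v k)) S"
    using z G S v by (auto simp: received_def encode_def intro!: eq_vecI)
  let ?q = "dec (received n (encode G (0\<^sub>v k)) S)"
  have "measure_pmf.prob ?q {v} = 1" "measure_pmf.prob ?q {0\<^sub>v k} = 1"
    using D v eq unfolding decodable_def by (metis, simp)
  moreover have "measure_pmf.prob ?q ({v} \<union> {0\<^sub>v k}) =
      measure_pmf.prob ?q {v} + measure_pmf.prob ?q {0\<^sub>v k}"
    using v by (intro measure_pmf.finite_measure_Union) auto
  ultimately show False
    using measure_pmf.prob_le_1[of ?q "{v} \<union> {0\<^sub>v k}"] by linarith
qed

lemma completion_time_first:
  assumes "0 \<le> t" "D {i\<in>{..<n}. x i \<le> t}"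
  obtains s where "0 \<le> s" "D {i\<in>{..<n}. x i \<le> s}" "completion_time D n x = ennreal s"
    "\<And>r. 0 \<le> r \<Longrightarrow> D {i\<in>{..<n}. x i \<le> r} \<Longrightarrow> s \<le> r"
proof -
  let ?F = "\<lambda>r. {i\<in>{..<n}. x i \<le> r}"
  let ?C = "insert 0 (x ` {..<n})"
  define B where "B = {c \<in> ?C. 0 \<le> c \<and> D (?F c)}"
  have dom: "\<exists>c\<in>B. c \<le> r" if r: "0 \<le> r" "D (?F r)" for r
  proof -
    define c where "c = Max {c \<in> ?C. c \<le> r}"
    have fin: "finite {c \<in> ?C. c \<le> r}" and ne: "{c \<in> ?C. c \<le> r} \<noteq> {}" using r by auto
    have c: "c \<in> ?C" "c \<le> r" using Max_in[OF fin ne] by (auto simp: c_def)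
    have ge: "d \<le> c" if "d \<in> ?C" "d \<le> r" for d
      using Max_ge[OF fin] that by (auto simp: c_def)
    have "?F c = ?F r" using c ge by fastforce
    then have "c \<in> B" using c ge r by (auto simp: B_def)
    then show ?thesis using c by blast
  qed
  have finB: "finite B" and neB: "B \<noteq> {}" using dom[OF assms] by (auto simp: B_def)
  define s where "s = Min B"
  have s: "s \<in> B" using Min_in[OF finB neB] by (simp add: s_def)
  have least: "s \<le> r" if "0 \<le> r" "D (?F r)" for r
    using dom[OF that] Min_le[OF finB] by (force simp: s_def)
  have "completion_time D n x = ennreal s"
    unfolding completion_time_def
    by (rule antisym, rule INF_lower)
       (use s least in \<open>auto simp: B_def intro!: INF_greatest ennreal_leI\<close>)
  then show ?thesis using that s least by (auto simp: B_def)
qed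

end

(* By monotonicity of decodability, T exceeds t exactly when the set of servers finished by t is
   not decodable, so E[T] is the integral of the tail P(T > t) by Tonelli.  At a fixed t the
   servers are independently unfinished with probability \<epsilon>(t), which identifies the tail with the
   failure probability.  The latter is a polynomial in the erasure probability; it equals 1 before
   time 1/k, as the empty set is not decodable, and after 1/k the substitution \<epsilon> = \<epsilon>(\<tau>) applies.
   The integral over \<epsilon> may diverge at 0, so everything stays in [0, \<infinity>] and the substitution is
   first made on compact intervals. *)
theory Submission
  imports Defs
begin

lemma emeasure_lborel_Ici: "emeasure lborel {a::real..} = \<infinity>"
proof -
  have "of_nat m \<le> emeasure lborel {a..}" for m
  proof -
    have "of_nat m = emeasure lborel {a..a + real m}"
      by (simp add: ennreal_of_nat_eq_real_of_nat)
    also have "\<dots> \<le> emeasure lborel {a..}" by (rule emeasure_mono) auto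
    finally show ?thesis .
  qed
  then have "(SUP m. of_nat m) \<le> emeasure lborel {a..}" by (rule SUP_least)
  then show ?thesis by (simp add: ennreal_SUP_of_nat_eq_top top_unique)
qed

text \<open>A pathwise layer-cake formula. By monotonicity the undecodable times in [0, \<infinity>)
  form an initial interval \<open>{0..<s}\<close>, where s is the first decodable time supplied by
  \<open>completion_time_first\<close>, and the Lebesgue measure of this interval is s.\<close>

lemma completion_time_eq_nn_integral:
  assumes mono: "\<And>S S'. S \<subseteq> S' \<Longrightarrow> S' \<subseteq> {..<n} \<Longrightarrow> D S \<Longrightarrow> D S'"
  shows "completion_time D n x =
    (\<integral>\<^sup>+\<tau>\<in>{0..}. indicator {\<tau>. \<not> D {i\<in>{..<n}. x i \<le> \<tau>}} \<tau> \<partial>lborel)"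
proof (cases "\<exists>t\<ge>0. D {i\<in>{..<n}. x i \<le> t}")
  case True
  then obtain t where t: "0 \<le> t" "D {i\<in>{..<n}. x i \<le> t}" by blast
  obtain s where s: "0 \<le> s" "D {i\<in>{..<n}. x i \<le> s}" "completion_time D n x = ennreal s"
    "\<And>r. 0 \<le> r \<Longrightarrow> D {i\<in>{..<n}. x i \<le> r} \<Longrightarrow> s \<le> r"
    using completion_time_first[of t D n x, OF t] by blast
  have "D {i\<in>{..<n}. x i \<le> r} \<longleftrightarrow> s \<le> r" if "0 \<le> r" for r
  proof
    assume "s \<le> r"
    then show "D {i\<in>{..<n}. x i \<le> r}" by (intro mono[OF _ _ s(2)]) auto
  qed (rule s(4)[OF that])
  then have eq: "(\<integral>\<^sup>+\<tau>\<in>{0..}. indicator {\<tau>. \<not> D {i\<in>{..<n}. x i \<le> \<tau>}} \<tau> \<partial>lborel) =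
      (\<integral>\<^sup>+\<tau>. indicator {0..<s} \<tau> \<partial>lborel)"
    by (intro nn_integral_cong) (auto simp: indicator_def)
  show ?thesis unfolding eq s(3) using s(1) by simp
next
  case False
  then have "{t. 0 \<le> t \<and> D {i\<in>{..<n}. x i \<le> t}} = {}" by blast
  \<comment> \<open>The infimum over the empty set is the top element of \<open>ennreal\<close>; on
    the other side the whole half-line is undecodable.\<close>
  then have "completion_time D n x = \<infinity>" by (simp add: completion_time_def)
  moreover have "(\<integral>\<^sup>+\<tau>\<in>{0..}. indicator {\<tau>. \<not> D {i\<in>{..<n}. x i \<le> \<tau>}} \<tau> \<partial>lborel) =
      (\<integral>\<^sup>+\<tau>. indicator {0::real..} \<tau> \<partial>lborel)"
    using False by (intro nn_integral_cong) (auto simp: indicator_def)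
  ultimately show ?thesis by (simp add: emeasure_lborel_Ici)
qed

text \<open>The events that the success set equals S are disjoint for distinct S, and each is an
  intersection of independent events, one per index, of probability q or 1 - q. Applied both to
  erased symbols and to unfinished servers, it produces the same sum for the two failure
  probabilities.\<close>

lemma (in prob_space) prob_indep_success_set:
  fixes X :: "'b \<Rightarrow> 'a \<Rightarrow> bool"
  assumes X: "indep_vars (\<lambda>_. count_space UNIV) X I" and I: "finite I" "I \<noteq> {}"
    and q: "\<And>i. i \<in> I \<Longrightarrow> prob {w\<in>space M. X i w} = q"
  shows "prob {w\<in>space M. P {i\<in>I. X i w}} =
    (\<Sum>S | S \<subseteq> I \<and> P S. q ^ card S * (1 - q) ^ (card I - card S))"
proof -
  have [measurable]: "X i \<in> measurable M (count_space UNIV)" if "i \<in> I" for i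
    using X that by (auto simp: indep_vars_def)
  let ?E = "\<lambda>S. {w\<in>space M. {i\<in>I. X i w} = S}"
  \<comment> \<open>Here \<open>I\<close> must be nonempty: an empty intersection would be
    \<open>UNIV\<close> instead of \<open>space M\<close>.\<close>
  have E: "?E S = (\<Inter>i\<in>I. X i -` {i \<in> S} \<inter> space M)" if "S \<subseteq> I" for S
    using that I by auto
  have meas: "?E S \<in> events" if "S \<subseteq> I" for S
    unfolding E[OF that] using I by (intro sets.finite_INT) auto
  have single: "prob (?E S) = q ^ card S * (1 - q) ^ (card I - card S)" if S: "S \<subseteq> I" for S
  proof -
    have fS: "finite S" using S I finite_subset by blast
    have q': "prob (X i -` {i \<in> S} \<inter> space M) = (if i \<in> S then q else 1 - q)" if "i \<in> I" for i
    proof -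
      have "X i -` {True} \<inter> space M = {w\<in>space M. X i w}"
           "X i -` {False} \<inter> space M = space M - {w\<in>space M. X i w}" by auto
      moreover have "{w\<in>space M. X i w} \<in> events" using that by measurable
      ultimately show ?thesis using q[OF that] by (auto simp: prob_compl)
    qed
    have "prob (?E S) = (\<Prod>i\<in>I. if i \<in> S then q else 1 - q)"
      unfolding E[OF S] using q' by (subst indep_varsD_finite[OF X I(2,1)]) auto
    also have "\<dots> = q ^ card S * (1 - q) ^ card (I - S)"
      using I S by (simp add: prod.If_cases Int_absorb1 Diff_eq Compl_eq)
    finally show ?thesis using S fS by (simp add: card_Diff_subset)
  qed
  have "{w\<in>space M. P {i\<in>I. X i w}} = (\<Union>S\<in>{S. S \<subseteq> I \<and> P S}. ?E S)" by auto
  also have "prob \<dots> = (\<Sum>S | S \<subseteq> I \<and> P S. prob (?E S))"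
    using I meas by (intro finite_measure_finite_Union) (auto simp: disjoint_family_on_def)
  finally show ?thesis using single by simp
qed

text \<open>S runs over the undecodable sets of surviving symbols. In this form the failure
  probability is visibly Borel measurable in \<epsilon>, whereas \<open>failure_prob\<close> hides
  \<epsilon> inside the measure.\<close>

definition failure_poly :: "(nat set \<Rightarrow> bool) \<Rightarrow> nat \<Rightarrow> real \<Rightarrow> real" where
  "failure_poly D n \<epsilon> =
     (\<Sum>S | S \<subseteq> {..<n} \<and> \<not> D S. (1 - \<epsilon>) ^ card S * \<epsilon> ^ (n - card S))"

lemma borel_measurable_failure_poly [measurable]: "failure_poly D n \<in> borel_measurable borel"
  unfolding failure_poly_def by measurable

text \<open>The coordinates under \<open>Pi_pmf\<close> are independent Bernoulli variables, and
  success means not being erased. The bounds on \<epsilon> make the mass of \<open>False\<close>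
  equal to 1 - \<epsilon>.\<close>

lemma failure_prob_eq_poly:
  assumes "0 \<le> \<epsilon>" "\<epsilon> \<le> 1" "0 < n"
  shows "failure_prob D \<epsilon> n = failure_poly D n \<epsilon>"
proof -
  let ?N = "Pi_pmf {..<n} False (\<lambda>_. bernoulli_pmf \<epsilon>)"
  have ind: "prob_space.indep_vars (measure_pmf ?N) (\<lambda>_. count_space UNIV) (\<lambda>i e. \<not> e i) {..<n}"
    by (rule prob_space.indep_vars_compose2[OF _ indep_vars_Pi_pmf])
       (auto simp: measure_pmf.prob_space_axioms)
  have q: "measure_pmf.prob ?N {e\<in>space (measure_pmf ?N). \<not> e i} = 1 - \<epsilon>"
    if "i \<in> {..<n}" for i
  proof -
    have "measure_pmf.prob ?N {e. \<not> e i} = measure_pmf.prob (map_pmf (\<lambda>e. e i) ?N) {False}"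
      by (simp add: vimage_def)
    also have "map_pmf (\<lambda>e. e i) ?N = bernoulli_pmf \<epsilon>"
      using that by (simp add: Pi_pmf_component)
    finally show ?thesis using assms by (simp add: measure_pmf_single)
  qed
  show ?thesis
    using measure_pmf.prob_indep_success_set[OF ind _ _ q, of "\<lambda>S. \<not> D S"] assms
    by (simp add: failure_prob_def failure_poly_def lessThan_empty_iff)
qed


text \<open>Continuity from below of the measure with density f.\<close>

lemma SUP_nn_integral_incseq:
  fixes f :: "'a \<Rightarrow> ennreal"
  assumes [measurable]: "f \<in> borel_measurable M" and A: "range A \<subseteq> sets M" "incseq A"
  shows "(SUP m. \<integral>\<^sup>+x\<in>A m. f x \<partial>M) = (\<integral>\<^sup>+x\<in>(\<Union>m. A m). f x \<partial>M)"
  using SUP_emeasure_incseq[of A "density M f"] A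
  by (simp add: emeasure_density range_subsetD sets.countable_UN)

text \<open>The substitution x = exp u holds on compact intervals; these exhaust (0, 1] and
  (-\<infinity>, 0] respectively, and taking suprema on both sides allows infinite values.\<close>

lemma nn_integral_exp_substitution:
  fixes f :: "real \<Rightarrow> ennreal"
  assumes [measurable]: "f \<in> borel_measurable borel"
  shows "(\<integral>\<^sup>+x\<in>{0<..1}. f x \<partial>lborel) = (\<integral>\<^sup>+u\<in>{..0}. f (exp u) * ennreal (exp u) \<partial>lborel)"
proof -
  \<comment> \<open>\<open>Suc m\<close> keeps the interval nondegenerate for m = 0, as the
    substitution rule requires.\<close>
  have *: "(\<integral>\<^sup>+x\<in>{exp (- real (Suc m))..1}. f x \<partial>lborel) =
      (\<integral>\<^sup>+u\<in>{- real (Suc m)..0}. f (exp u) * ennreal (exp u) \<partial>lborel)" for m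
    using nn_integral_substitution_aux[of f "- real (Suc m)" 0 exp exp]
    by (simp add: DERIV_exp continuous_on_exp[OF continuous_on_id])
  have x: "\<exists>m. exp (- real (Suc m)) \<le> x" if "0 < x" for x :: real
  proof -
    obtain m where "- ln x < real m" using reals_Archimedean2 by blast
    then have "exp (- real (Suc m)) \<le> exp (ln x)" by (subst exp_le_cancel_iff) simp
    then show ?thesis using that by auto
  qed
  have "(\<Union>m. {exp (- real (Suc m))..1}) = {0<..1}"
  proof safe
    fix m and y :: real assume "y \<in> {exp (- real (Suc m))..1}"
    then show "y \<in> {0<..1}" using less_le_trans[OF exp_gt_zero] by fastforce
  next
    fix y :: real assume "y \<in> {0<..1}"
    then show "y \<in> (\<Union>m. {exp (- real (Suc m))..1})" using x[of y] by auto
  qed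
  moreover have "(\<Union>m. {- real (Suc m)..0}) = {..0}"
  proof safe
    fix y :: real assume "y \<le> 0"
    obtain m where "- y < real m" using reals_Archimedean2 by blast
    with \<open>y \<le> 0\<close> show "y \<in> (\<Union>m. {- real (Suc m)..0})" by (auto intro!: exI[of _ m])
  qed auto
  moreover have "incseq (\<lambda>m. {exp (- real (Suc m))..1})" "incseq (\<lambda>m. {- real (Suc m)..0})"
    by (auto simp: incseq_def)
  ultimately show ?thesis
    using SUP_nn_integral_incseq[of f lborel "\<lambda>m. {exp (- real (Suc m))..1}"]
      SUP_nn_integral_incseq[of "\<lambda>u. f (exp u) * ennreal (exp u)" lborel "\<lambda>m. {- real (Suc m)..0}"] *
    by (simp add: image_subset_iff)
qed

text \<open>Split at 1/k. Before it the erasure probability is 1, which gives the first summand.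
  After it, u = ln \<epsilon> is affine in \<tau> with slope -\<mu>k, and d\<epsilon>/\<epsilon> =
  du.\<close>

lemma nn_integral_erasure_prob:
  fixes f :: "real \<Rightarrow> real"
  assumes f [measurable]: "f \<in> borel_measurable borel" and k: "0 < k" and \<mu>: "0 < \<mu>"
  shows "(\<integral>\<^sup>+\<tau>\<in>{0..}. ennreal (f (erasure_prob k \<mu> \<tau>)) \<partial>lborel) =
    ennreal (f 1) * ennreal (1 / real k) +
    ennreal (1 / (\<mu> * real k)) * (\<integral>\<^sup>+\<epsilon>\<in>{0..1}. ennreal (f \<epsilon> / \<epsilon>) \<partial>lborel)"
proof -
  let ?g = "\<lambda>u. ennreal (f (exp u)) * indicator {..0} u"
  let ?J = "\<integral>\<^sup>+u. ?g u \<partial>lborel"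
  have "(\<integral>\<^sup>+\<epsilon>\<in>{0..1}. ennreal (f \<epsilon> / \<epsilon>) \<partial>lborel) = (\<integral>\<^sup>+\<epsilon>\<in>{0<..1}. ennreal (f \<epsilon> / \<epsilon>) \<partial>lborel)"
    by (intro nn_integral_cong) (auto simp: indicator_def)
  also have "\<dots> = (\<integral>\<^sup>+u\<in>{..0}. ennreal (f (exp u) / exp u) * ennreal (exp u) \<partial>lborel)"
    by (rule nn_integral_exp_substitution) measurable
  also have "\<dots> = ?J"
    by (intro nn_integral_cong) (simp flip: ennreal_mult'')
  finally have J: "(\<integral>\<^sup>+\<epsilon>\<in>{0..1}. ennreal (f \<epsilon> / \<epsilon>) \<partial>lborel) = ?J" .
  \<comment> \<open>The affine map \<mu> - \<mu>k\<tau> is the logarithm of the erasure probability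
    for \<tau> \<ge> 1/k, and it is nonpositive exactly there.\<close>
  have "?J = ennreal (\<mu> * real k) * (\<integral>\<^sup>+\<tau>. ?g (\<mu> + (- (\<mu> * real k)) * \<tau>) \<partial>lborel)"
    using k \<mu> by (subst nn_integral_real_affine[where c = "- (\<mu> * real k)" and t = \<mu>]) auto
  also have "(\<integral>\<^sup>+\<tau>. ?g (\<mu> + (- (\<mu> * real k)) * \<tau>) \<partial>lborel) =
      (\<integral>\<^sup>+\<tau>\<in>{1 / real k..}. ennreal (f (erasure_prob k \<mu> \<tau>)) \<partial>lborel)"
    using k \<mu> by (intro nn_integral_cong)
      (auto simp: indicator_def erasure_prob_def field_simps)
  finally have "ennreal (1 / (\<mu> * real k)) * ?J =
      ennreal (1 / (\<mu> * real k)) * ennreal (\<mu> * real k) *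
      (\<integral>\<^sup>+\<tau>\<in>{1 / real k..}. ennreal (f (erasure_prob k \<mu> \<tau>)) \<partial>lborel)"
    by (simp add: mult.assoc)
  also have "ennreal (1 / (\<mu> * real k)) * ennreal (\<mu> * real k) = 1"
    using k \<mu> by (simp flip: ennreal_mult')
  finally have tail: "(\<integral>\<^sup>+\<tau>\<in>{1 / real k..}. ennreal (f (erasure_prob k \<mu> \<tau>)) \<partial>lborel) =
      ennreal (1 / (\<mu> * real k)) * ?J" by simp
  have [measurable]: "erasure_prob k \<mu> \<in> borel_measurable borel"
    unfolding erasure_prob_def by measurable
  have "(\<integral>\<^sup>+\<tau>\<in>{0..}. ennreal (f (erasure_prob k \<mu> \<tau>)) \<partial>lborel) =
      (\<integral>\<^sup>+\<tau>. ennreal (f 1) * indicator {0..<1 / real k} \<tau> +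
          ennreal (f (erasure_prob k \<mu> \<tau>)) * indicator {1 / real k..} \<tau> \<partial>lborel)"
    using k by (intro nn_integral_cong)
      (auto simp: indicator_def erasure_prob_def intro: order_trans[of 0 "1 / real k"])
  also have "\<dots> = ennreal (f 1) * ennreal (1 / real k) + ennreal (1 / (\<mu> * real k)) * ?J"
    by (subst nn_integral_add) (auto simp: nn_integral_cmult tail)
  finally show ?thesis unfolding J .
qed

text \<open>Tonelli applied to the pathwise formula; the work lies in joint measurability in w and
  \<tau>.\<close>

lemma (in prob_space) nn_integral_completion_time:
  fixes T :: "nat \<Rightarrow> 'a \<Rightarrow> real"
  assumes mono: "\<And>S S'. S \<subseteq> S' \<Longrightarrow> S' \<subseteq> {..<n} \<Longrightarrow> D S \<Longrightarrow> D S'"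
    and T: "\<And>i. i < n \<Longrightarrow> random_variable borel (T i)"
  shows "(\<integral>\<^sup>+w. completion_time D n (\<lambda>i. T i w) \<partial>M) =
    (\<integral>\<^sup>+\<tau>\<in>{0..}. ennreal (prob {w\<in>space M. \<not> D {i\<in>{..<n}. T i w \<le> \<tau>}}) \<partial>lborel)"
proof -
  interpret pair_sigma_finite M "lborel :: real measure" ..
  have [measurable]: "T i \<in> borel_measurable M" if "i \<in> {..<n}" for i using T that by simp
  let ?Q = "\<lambda>w \<tau>. \<not> D {i\<in>{..<n}. T i w \<le> \<tau>}"
  \<comment> \<open>\<open>D\<close> is an arbitrary predicate on sets, so its failure is expressed
    as a finite disjunction over the undecodable S of finitely many comparisons of
    \<open>T i w\<close> with \<tau>, which are jointly measurable.\<close>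
  have Q: "?Q w \<tau> \<longleftrightarrow> (\<exists>S\<in>{S. S \<subseteq> {..<n} \<and> \<not> D S}. \<forall>i\<in>{..<n}. i \<in> S \<longleftrightarrow> T i w \<le> \<tau>)"
    (is "_ \<longleftrightarrow> ?R w \<tau>") for w \<tau>
  proof
    assume "?R w \<tau>"
    then obtain S where S: "S \<subseteq> {..<n}" "\<not> D S" "\<forall>i\<in>{..<n}. i \<in> S \<longleftrightarrow> T i w \<le> \<tau>" by auto
    then have "{i\<in>{..<n}. T i w \<le> \<tau>} = S" by auto
    with S show "?Q w \<tau>" by simp
  qed (auto intro!: exI[of _ "{i\<in>{..<n}. T i w \<le> \<tau>}"])
  have fin: "finite {S. S \<subseteq> {..<n} \<and> \<not> D S}"
    by (rule finite_subset[of _ "Pow {..<n}"]) auto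
  have pred: "Measurable.pred (M \<Otimes>\<^sub>M lborel) (\<lambda>z. ?Q (fst z) (snd z))"
    unfolding Q by (intro pred_intros_finite fin) measurable
  have ev: "{w\<in>space M. ?Q w \<tau>} \<in> events" for \<tau>
    unfolding Q by (intro predE pred_intros_finite fin) measurable
  \<comment> \<open>The set inside the indicator depends on w, so measurability is first shown for a
    conditional and then transferred.\<close>
  have "(\<lambda>z. if ?Q (fst z) (snd z) then indicator {0..} (snd z) else 0) \<in>
      borel_measurable (M \<Otimes>\<^sub>M lborel)"
    by (rule measurable_If[OF _ _ predE[OF pred]]) measurable
  also have "(\<lambda>z. if ?Q (fst z) (snd z) then indicator {0..} (snd z) else 0) =
      (\<lambda>z. indicator {\<tau>. ?Q (fst z) \<tau>} (snd z) * indicator {0..} (snd z) :: ennreal)"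
    by (simp add: fun_eq_iff indicator_def)
  finally have meas: "\<dots> \<in> borel_measurable (M \<Otimes>\<^sub>M lborel)" .
  have "(\<integral>\<^sup>+w. completion_time D n (\<lambda>i. T i w) \<partial>M) =
      (\<integral>\<^sup>+w. (\<integral>\<^sup>+\<tau>\<in>{0..}. indicator {\<tau>. ?Q w \<tau>} \<tau> \<partial>lborel) \<partial>M)"
    by (rule nn_integral_cong, rule completion_time_eq_nn_integral, rule mono)
  also have "\<dots> = (\<integral>\<^sup>+\<tau>. (\<integral>\<^sup>+w. indicator {\<tau>. ?Q w \<tau>} \<tau> * indicator {0..} \<tau> \<partial>M) \<partial>lborel)"
    using meas by (intro Fubini'[symmetric]) (simp add: case_prod_beta')
  also have "\<dots> = (\<integral>\<^sup>+\<tau>\<in>{0..}. ennreal (prob {w\<in>space M. ?Q w \<tau>}) \<partial>lborel)"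
  proof (intro nn_integral_cong)
    fix \<tau> :: real
    have "(\<integral>\<^sup>+w. indicator {\<tau>. ?Q w \<tau>} \<tau> * indicator {0..} \<tau> \<partial>M) =
        (\<integral>\<^sup>+w. indicator {0..} \<tau> * indicator {w\<in>space M. ?Q w \<tau>} w \<partial>M)"
      by (intro nn_integral_cong) (auto simp: indicator_def)
    also have "\<dots> = ennreal (prob {w\<in>space M. ?Q w \<tau>}) * indicator {0..} \<tau>"
      using ev by (simp add: nn_integral_cmult emeasure_eq_measure mult.commute)
    finally show "(\<integral>\<^sup>+w. indicator {\<tau>. ?Q w \<tau>} \<tau> * indicator {0..} \<tau> \<partial>M) = \<dots>" .
  qed
  finally show ?thesis .
qed

theorem lemma1:
  fixes n k :: nat and \<mu> :: real
    and G :: "'f::field mat" and dec :: "'f decoder"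
    and M :: "'w measure" and T :: "nat \<Rightarrow> 'w \<Rightarrow> real"
  assumes "1 \<le> k" and "k \<le> n" and "0 < \<mu>"
    and "linear_code n k G" and "monotone_decoder n k G dec"
    and "prob_space M"
    and "prob_space.indep_vars M (\<lambda>_. borel) T {..<n}"
    and "\<And>i t. i < n \<Longrightarrow> Sigma_Algebra.measure M {w \<in> space M. T i w \<le> t} = run_time_cdf k \<mu> t"
  shows "(\<integral>\<^sup>+w. completion_time (decodable n k G dec) n (\<lambda>i. T i w) \<partial>M)
           = (\<integral>\<^sup>+\<tau>\<in>{0..}. ennreal (failure_prob (decodable n k G dec) (erasure_prob k \<mu> \<tau>) n) \<partial>lborel)
       \<and> (\<integral>\<^sup>+\<tau>\<in>{0..}. ennreal (failure_prob (decodable n k G dec) (erasure_prob k \<mu> \<tau>) n) \<partial>lborel)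
           = ennreal (1 / real k) + ennreal (1 / (\<mu> * real k))
               * (\<integral>\<^sup>+\<epsilon>\<in>{0..1}. ennreal (failure_prob (decodable n k G dec) \<epsilon> n / \<epsilon>) \<partial>lborel)"
proof -
  interpret prob_space M by fact
  let ?D = "decodable n k G dec" and ?\<epsilon> = "erasure_prob k \<mu>"
  have n: "0 < n" and k: "0 < k" using assms(1,2) by auto
  have rv: "random_variable borel (T i)" if "i < n" for i
    using assms(7) that by (auto simp: indep_vars_def)
  have \<epsilon>: "0 \<le> ?\<epsilon> \<tau>" "?\<epsilon> \<tau> \<le> 1" for \<tau>
    using \<open>0 < \<mu>\<close> k by (auto simp: erasure_prob_def field_simps)
  \<comment> \<open>At a fixed \<tau> the events of having finished are independent across servers,
    each of probability 1 - \<epsilon>(\<tau>).\<close>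
  have poly: "prob {w\<in>space M. \<not> ?D {i\<in>{..<n}. T i w \<le> \<tau>}} = failure_poly ?D n (?\<epsilon> \<tau>)" for \<tau>
  proof -
    have "indep_vars (\<lambda>_. count_space UNIV) (\<lambda>i w. T i w \<le> \<tau>) {..<n}"
      by (rule indep_vars_compose2[OF assms(7)]) measurable
    moreover have "prob {w\<in>space M. T i w \<le> \<tau>} = 1 - ?\<epsilon> \<tau>" if "i \<in> {..<n}" for i
      using assms(8)[of i \<tau>] that by (simp add: run_time_cdf_def erasure_prob_def)
    ultimately show ?thesis
      using prob_indep_success_set[of "\<lambda>i w. T i w \<le> \<tau>" "{..<n}" "1 - ?\<epsilon> \<tau>" "\<lambda>S. \<not> ?D S"] n
      by (simp add: failure_poly_def lessThan_empty_iff)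
  qed
  have mono: "?D S'" if "S \<subseteq> S'" "S' \<subseteq> {..<n}" "?D S" for S S'
    using assms(5) that unfolding monotone_decoder_def by blast
  have "\<not> ?D {}"
    using decodable_imp_card_ge[of G k n "{}" dec] assms(4) k by (auto simp: linear_code_def)
  \<comment> \<open>At \<epsilon> = 1 the factor \<open>(1 - \<epsilon>) ^ card S\<close> vanishes
    unless S is empty, where \<open>0 ^ 0 = 1\<close>. The empty set does occur in the sum, being
    undecodable because k is positive.\<close>
  have one: "failure_poly ?D n 1 = 1"
  proof -
    have "failure_poly ?D n 1 = (\<Sum>S | S \<subseteq> {..<n} \<and> \<not> ?D S. if S = {} then 1 else 0)"
      unfolding failure_poly_def
      by (intro sum.cong) (auto simp: power_0_left dest: finite_subset)
    also have "\<dots> = 1"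
      using \<open>\<not> ?D {}\<close> by (subst sum.delta) auto
    finally show ?thesis .
  qed
  have prob: "failure_prob ?D (?\<epsilon> \<tau>) n = failure_poly ?D n (?\<epsilon> \<tau>)" for \<tau>
    by (intro failure_prob_eq_poly \<epsilon> n)
  have int: "(\<integral>\<^sup>+\<epsilon>\<in>{0..1}. ennreal (failure_prob ?D \<epsilon> n / \<epsilon>) \<partial>lborel) =
      (\<integral>\<^sup>+\<epsilon>\<in>{0..1}. ennreal (failure_poly ?D n \<epsilon> / \<epsilon>) \<partial>lborel)"
    using n by (intro nn_integral_cong) (auto simp: indicator_def failure_prob_eq_poly)
  have "(\<integral>\<^sup>+w. completion_time ?D n (\<lambda>i. T i w) \<partial>M) =
      (\<integral>\<^sup>+\<tau>\<in>{0..}. ennreal (prob {w\<in>space M. \<not> ?D {i\<in>{..<n}. T i w \<le> \<tau>}}) \<partial>lborel)"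
    by (rule nn_integral_completion_time) (erule (2) mono, erule rv)
  then show ?thesis
    unfolding prob int poly
    using nn_integral_erasure_prob[of "failure_poly ?D n" k \<mu>] k \<open>0 < \<mu>\<close> by (simp add: one)
qed

end
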